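(* Let $n=sp^k$, where $s>1$ is a squarefree integer, $p$ is a prime not dividing $s$, and $k$ is a positive integer. Then $$I_r(\mathbb{Z}/n\mathbb{Z}) \leq \mathsf{D}((\mathbb{Z}/n\mathbb{Z})^\times) + (k - 1)+(\phi(s)-1),$$ where $\phi$ is Euler's totient function.
   Context: For a finite commutative ring $R$, $I_r(R)$ (the Erdős–Burgess constant of the multiplicative semigroup of $R$) is the smallest positive integer $t$ such that every sequence of $t$ (not necessarily distinct) elements of $R$ contains a nonempty subsequence whose elements multiply to an idempotent element of $R$ (an element $x$ with $x^2=x$). For a finite abelian group $G$, the Davenport constant $\mathsf{D}(G)$ is the smallest positive integer $t$ such that every sequence of $t$ elements of $G$ contains a nonempty subsequence whose elements multiply (in the group operation) to the identity. $(\mathbb{Z}/n\mathbb{Z})^\times$ denotes the unit group of $\mathbb{Z}/n\mathbb{Z}$. *)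

theory Defs
  imports "HOL-Number_Theory.Number_Theory" "HOL-Computational_Algebra.Squarefree" "HOL-Library.Sublist"
begin

(* Sequences are lists.  Only commutative structures are intended, so the order in which
   the terms are multiplied is immaterial. *)
definition seq_prod :: "('a, 'b) monoid_scheme \<Rightarrow> 'a list \<Rightarrow> 'a" where
  "seq_prod G xs = foldr (\<otimes>\<^bsub>G\<^esub>) xs \<one>\<^bsub>G\<^esub>"

(* For a finite commutative ring R such a t exists, because every element of R has an
   idempotent positive power and every sufficiently long sequence repeats some element
   often enough; so LEAST denotes a genuine minimum. *)
definition erdos_burgess_constant :: "('a, 'b) ring_scheme \<Rightarrow> nat" where
  "erdos_burgess_constant R =
     (LEAST t. 0 < t \<and>
        (\<forall>xs. length xs = t \<and> set xs \<subseteq> carrier R \<longrightarrow>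
           (\<exists>ys. subseq ys xs \<and> ys \<noteq> [] \<and>
              seq_prod R ys \<otimes>\<^bsub>R\<^esub> seq_prod R ys = seq_prod R ys)))"

(* For a finite abelian group G, written multiplicatively, t = order G is admissible. *)
definition davenport_constant :: "('a, 'b) monoid_scheme \<Rightarrow> nat" where
  "davenport_constant G =
     (LEAST t. 0 < t \<and>
        (\<forall>xs. length xs = t \<and> set xs \<subseteq> carrier G \<longrightarrow>
           (\<exists>ys. subseq ys xs \<and> ys \<noteq> [] \<and> seq_prod G ys = \<one>\<^bsub>G\<^esub>)))"

end

theory Submission
  imports Defs
begin

text \<open>
  Write a residue modulo \<open>n = s p\<^sup>k\<close> as a pair modulo \<open>s\<close> and modulo \<open>p\<^sup>k\<close>.  Modulo the squarefree
  number \<open>s\<close> we are in a product of fields; replacing zero coordinates by one turns every element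
  into a unit, and whenever a product of the modified elements is one, the product of the original
  ones has all its coordinates in \<open>{0, 1}\<close> and hence is idempotent.  If at least \<open>D\<close> of the given
  elements are prime to \<open>p\<close>, the Davenport constant \<open>D\<close> of the unit group modulo \<open>n\<close>, applied to
  the modified elements, yields an idempotent product.  Otherwise at least \<open>k + \<phi>(s) - 1\<close> elements
  are divisible by \<open>p\<close>.  Among these take a subsequence of maximal length whose modified product is
  one modulo \<open>s\<close>: fewer than \<open>\<phi>(s)\<close> elements remain, so it has at least \<open>k\<close> terms, and its product
  vanishes modulo \<open>p\<^sup>k\<close>.
\<close>

section \<open>Products of sequences in a group\<close>

lemma seq_prod_Nil [simp]: "seq_prod G [] = \<one>\<^bsub>G\<^esub>"
  and seq_prod_Cons [simp]: "seq_prod G (x # xs) = x \<otimes>\<^bsub>G\<^esub> seq_prod G xs"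
  by (simp_all add: seq_prod_def)

lemma (in monoid) seq_prod_closed:
  "set xs \<subseteq> carrier G \<Longrightarrow> seq_prod G xs \<in> carrier G"
  by (induction xs) auto

lemma (in monoid) seq_prod_append:
  "set xs \<subseteq> carrier G \<Longrightarrow> set ys \<subseteq> carrier G \<Longrightarrow>
    seq_prod G (xs @ ys) = seq_prod G xs \<otimes> seq_prod G ys"
  by (induction xs) (auto simp: seq_prod_closed m_assoc)

text \<open>Pigeonhole on prefix products: two prefixes with equal product differ by a nonempty
  block, and cancelling the shorter prefix leaves product one for that block. This makes the group
  order admissible in \<open>davenport_constant\<close>.\<close>

lemma (in group) exists_subseq_prod_one:
  assumes fin: "finite (carrier G)" and len: "length xs \<ge> order G"
    and xs: "set xs \<subseteq> carrier G"
  shows "\<exists>ys. subseq ys xs \<and> ys \<noteq> [] \<and> seq_prod G ys = \<one>"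
proof -
  \<comment> \<open>The empty prefix counts too, so there are \<open>length xs + 1\<close> indices,
    more than the group has elements.\<close>
  define f where "f i = seq_prod G (take i xs)" for i
  have sub: "f ` {..length xs} \<subseteq> carrier G"
    using xs by (auto simp: f_def intro!: seq_prod_closed dest: in_set_takeD)
  have "\<not> inj_on f {..length xs}"
  proof
    assume "inj_on f {..length xs}"
    then have "card {..length xs} \<le> card (carrier G)"
      using card_inj_on_le fin sub by blast
    then show False using len by (simp add: order_def)
  qed
  then obtain i j where ij: "i < j" "j \<le> length xs" "f i = f j"
    unfolding inj_on_def by (metis atMost_iff linorder_neqE_nat)
  define ys where "ys = drop i (take j xs)"
  have take_j: "take j xs = take i xs @ ys"
    using ij append_take_drop_id[of i "take j xs"] by (simp add: ys_def)
  have ys: "set ys \<subseteq> carrier G" and ti: "set (take i xs) \<subseteq> carrier G"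
    using xs by (auto simp: ys_def dest!: in_set_takeD in_set_dropD)
  have "f i \<otimes> seq_prod G ys = f i"
    using ij(3) seq_prod_append[OF ti ys] by (simp add: f_def take_j)
  then have "seq_prod G ys = \<one>"
    using ti ys by (simp add: f_def seq_prod_closed l_cancel_one)
  moreover have "subseq ys xs"
  proof -
    have "subseq ys (take j xs)" unfolding take_j by (rule list_emb_append2) simp
    moreover have "subseq (take j xs) (take j xs @ drop j xs)"
      by (rule subseq_rev_drop_many) simp
    ultimately show ?thesis by (metis append_take_drop_id subseq_order.trans)
  qed
  moreover have "ys \<noteq> []" using ij by (simp add: ys_def)
  ultimately show ?thesis by blast
qed

text \<open>The group order witnesses the condition under \<open>LEAST\<close>, so the least value
  exists and itself has the defining property.\<close>

lemma (in group) davenport_constant_props: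
  assumes fin: "finite (carrier G)"
  shows "0 < davenport_constant G" "davenport_constant G \<le> order G"
    and "\<And>xs. length xs = davenport_constant G \<Longrightarrow> set xs \<subseteq> carrier G \<Longrightarrow>
           \<exists>ys. subseq ys xs \<and> ys \<noteq> [] \<and> seq_prod G ys = \<one>"
proof -
  let ?P = "\<lambda>t. 0 < t \<and> (\<forall>xs. length xs = t \<and> set xs \<subseteq> carrier G \<longrightarrow>
           (\<exists>ys. subseq ys xs \<and> ys \<noteq> [] \<and> seq_prod G ys = \<one>))"
  have P: "?P (order G)"
    using exists_subseq_prod_one[OF fin] fin order_gt_0_iff_finite by auto
  from LeastI[of ?P, OF P] Least_le[of ?P, OF P]
  show "0 < davenport_constant G" "davenport_constant G \<le> order G"
    "\<And>xs. length xs = davenport_constant G \<Longrightarrow> set xs \<subseteq> carrier G \<Longrightarrow>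
           \<exists>ys. subseq ys xs \<and> ys \<noteq> [] \<and> seq_prod G ys = \<one>"
    unfolding davenport_constant_def by blast+
qed

section \<open>Products of residues\<close>

lemma subseq_mapE:
  assumes "subseq ys (map f xs)"
  obtains zs where "subseq zs xs" "ys = map f zs"
  using assms by (metis nths_map subseq_conv_nths)

lemma subseq_nth_filter: "subseq (map ((!) xs) (filter P [0..<length xs])) xs"
  by (metis map_nth subseq_filter_left subseq_map)

context residues
begin

lemma seq_prod_eq_prod_list: "seq_prod R xs = prod_list xs mod m"
  by (induction xs) (simp_all add: res_mult_eq one_cong mod_mult_right_eq)

lemma group_units: "group (units_of R)"
  by (rule units_group)

lemma seq_prod_units_of: "seq_prod (units_of R) xs = seq_prod R xs"
  by (simp add: seq_prod_def units_of_mult units_of_one)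

lemma davenport_constant_units_pos: "0 < davenport_constant (units_of R)"
  and davenport_constant_units_le: "davenport_constant (units_of R) \<le> totient (nat m)"
  using group.davenport_constant_props(1,2)[OF group_units]
  by (simp_all add: units_of_carrier order_def totient_eq)

text \<open>Index sets replace lists here: equal values at different indices stay separate terms,
  and disjoint selections can later be joined by a union.\<close>

lemma davenport_constant_units_prod:
  fixes y :: "'i \<Rightarrow> int"
  assumes "finite A" and card: "card A \<ge> davenport_constant (units_of R)"
    and cop: "\<And>i. i \<in> A \<Longrightarrow> coprime (y i) m"
  obtains I where "I \<subseteq> A" "I \<noteq> {}" "[(\<Prod>i\<in>I. y i) = 1] (mod m)"
proof -
  obtain B where B: "B \<subseteq> A" "card B = davenport_constant (units_of R)" "finite B"
    using card by (metis obtain_subset_with_card_n)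
  obtain zs where zs: "set zs = B" "distinct zs"
    using finite_distinct_list[OF B(3)] by blast
  define xs where "xs = map (\<lambda>i. y i mod m) zs"
  have "length xs = davenport_constant (units_of R)"
    using zs B distinct_card[of zs] by (simp add: xs_def)
  moreover have "set xs \<subseteq> carrier (units_of R)"
    using zs B cop m_gt_one by (auto simp: xs_def units_of_carrier intro!: mod_in_res_units)
  ultimately obtain ys where ys: "subseq ys xs" "ys \<noteq> []"
      "seq_prod (units_of R) ys = \<one>\<^bsub>units_of R\<^esub>"
    using group.davenport_constant_props(3)[OF group_units, of xs]
    by (auto simp: units_of_carrier)
  obtain ws where ws: "subseq ws zs" "ys = map (\<lambda>i. y i mod m) ws"
    using ys(1) unfolding xs_def by (rule subseq_mapE)
  have dist: "distinct ws" and sub: "set ws \<subseteq> set zs"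
    using ws(1) zs(2) by (auto simp: subseq_conv_nths dest: in_set_nthsD)
  have "prod_list ys mod m = 1"
    using ys(3) by (simp add: seq_prod_units_of units_of_one seq_prod_eq_prod_list res_one_eq)
  moreover have "prod_list ys = (\<Prod>i\<in>set ws. y i mod m)"
    using dist by (simp add: ws(2) prod.distinct_set_conv_list)
  ultimately have "(\<Prod>i\<in>set ws. y i) mod m = 1"
    by (simp add: mod_prod_eq)
  then have "[(\<Prod>i\<in>set ws. y i) = 1] (mod m)"
    using m_gt_one by (simp add: cong_def)
  then show ?thesis
    using that[of "set ws"] sub zs B ys(2) ws(2) by auto
qed

text \<open>Extremal argument: let \<open>I\<close> have maximal size among the sets with product
  one. If \<open>totient (nat m)\<close> indices were left over, the Davenport constant would supply
  a nonempty \<open>J\<close> among them, and \<open>I \<union> J\<close> would be larger.\<close>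

lemma exists_large_prod_cong_1:
  fixes y :: "'i \<Rightarrow> int"
  assumes fin: "finite A" and card: "card A + 1 \<ge> k + totient (nat m)"
    and cop: "\<And>i. i \<in> A \<Longrightarrow> coprime (y i) m"
  obtains I where "I \<subseteq> A" "card I \<ge> k" "[(\<Prod>i\<in>I. y i) = 1] (mod m)"
proof -
  define F where "F = {I. I \<subseteq> A \<and> [(\<Prod>i\<in>I. y i) = 1] (mod m)}"
  \<comment> \<open>The empty product is one, so the maximum is taken over a nonempty set.\<close>
  have "finite F" "{} \<in> F"
    using fin by (auto simp: F_def)
  then have "Max (card ` F) \<in> card ` F" by (intro Max_in) auto
  then obtain I where I: "I \<in> F" "Max (card ` F) = card I" by auto
  have max: "card J \<le> card I" if "J \<in> F" for J
    unfolding I(2)[symmetric] using \<open>finite F\<close> that by simp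
  have IA: "I \<subseteq> A" and finI: "finite I"
    using I fin by (auto simp: F_def intro: finite_subset)
  have "card (A - I) < totient (nat m)"
  proof (rule ccontr)
    assume "\<not> ?thesis"
    then have "card (A - I) \<ge> davenport_constant (units_of R)"
      using davenport_constant_units_le by simp
    then obtain J where J: "J \<subseteq> A - I" "J \<noteq> {}" "[(\<Prod>i\<in>J. y i) = 1] (mod m)"
      using davenport_constant_units_prod[of "A - I" y] fin cop by blast
    have finJ: "finite J"
      using J fin by (meson finite_Diff finite_subset)
    have disj: "I \<inter> J = {}" using J by auto
    have "[(\<Prod>i\<in>I \<union> J. y i) = 1 * 1] (mod m)"
      unfolding prod.union_disjoint[OF finI finJ disj]
      using I J by (intro cong_mult) (auto simp: F_def)
    then have "I \<union> J \<in> F"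
      using J IA by (auto simp: F_def)
    then have "card (I \<union> J) \<le> card I" by (rule max)
    moreover have "card J > 0" using J finJ by (simp add: card_gt_0_iff)
    ultimately show False
      by (simp add: card_Un_disjoint[OF finI finJ disj])
  qed
  moreover have "card (A - I) = card A - card I"
    using IA finI by (rule card_Diff_subset[rotated])
  \<comment> \<open>At most \<open>totient (nat m) - 1\<close> indices lie outside \<open>I\<close>;
    the missing one accounts for the \<open>+ 1\<close> in the hypothesis.\<close>
  ultimately have "card I \<ge> k"
    using card by linarith
  then show ?thesis
    using that I by (auto simp: F_def)
qed

end

section \<open>Replacing residues by units\<close>

lemma squarefree_int: "squarefree (int s)" if "squarefree s"
proof (rule squarefreeI)
  fix x :: int assume "x ^ 2 dvd int s"
  then have "nat \<bar>x\<bar> ^ 2 dvd s"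
    by (metis nat_abs_dvd_iff nat_power_eq abs_ge_zero power_abs)
  then have "nat \<bar>x\<bar> dvd 1" using that squarefreeD by blast
  then show "x dvd 1" by simp
qed

text \<open>In a squarefree element every prime has multiplicity at most one, so its prime divisors
  alone decide what it divides.\<close>

lemma squarefree_dvdI:
  fixes a b :: "'a :: factorial_semiring"
  assumes "squarefree a" and "\<And>q. prime q \<Longrightarrow> q dvd a \<Longrightarrow> q dvd b"
  shows "a dvd b"
proof (cases "b = 0")
  case False
  have a: "a \<noteq> 0" using assms(1) by auto
  show ?thesis
  proof (rule multiplicity_le_imp_dvd[OF a])
    fix q :: 'a assume q: "prime q"
    show "multiplicity q a \<le> multiplicity q b"
    proof (cases "q dvd a")
      case True
      have "multiplicity q a \<le> 1"
        using assms(1) a q by (simp add: squarefree_factorial_semiring'')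
      also have "1 \<le> multiplicity q b"
        using assms(2)[OF q True] q False by (intro multiplicity_geI) auto
      finally show ?thesis .
    qed (simp add: not_dvd_imp_multiplicity_0)
  qed
qed simp

text \<open>The primes of \<open>s\<close> dividing \<open>x\<close> are those of
  \<open>gcd x s\<close>. Chinese remaindering makes \<open>y\<close> equal to 1 modulo this gcd and
  equal to \<open>x\<close> modulo the cofactor and modulo \<open>m\<close>. It is applied with
  \<open>m\<close> the prime power for terms prime to \<open>p\<close>, and with
  \<open>m = 1\<close> for multiples of \<open>p\<close>.\<close>

lemma exists_unit_replacement:
  fixes s m x :: int
  assumes sf: "squarefree s" and sm: "coprime s m" and xm: "coprime x m"
  obtains y where "coprime y (s * m)" "[y = x] (mod m)"
    "\<And>q. prime q \<Longrightarrow> q dvd s \<Longrightarrow> \<not> q dvd x \<Longrightarrow> [y = x] (mod q)"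
proof -
  define g where "g = gcd x s"
  obtain h where h: "s = g * h" unfolding g_def using gcd_dvd2 by (rule dvdE)
  \<comment> \<open>This is where squarefreeness enters: a common divisor of \<open>g\<close> and
    \<open>h\<close> would divide \<open>s\<close> twice.\<close>
  have gh: "coprime g h"
  proof (rule coprimeI)
    fix c assume "c dvd g" "c dvd h"
    then have "c ^ 2 dvd s" unfolding h power2_eq_square by (rule mult_dvd_mono)
    then show "c dvd 1" using sf squarefreeD by blast
  qed
  have gm: "coprime g m" using sm unfolding h by simp
  obtain y where y: "[y = 1] (mod g)" "[y = x] (mod (h * m))"
    using binary_chinese_remainder_int[of g "h * m" 1 x] gh gm by auto
  have yh: "[y = x] (mod h)" and ym: "[y = x] (mod m)"
    using y(2) by (auto intro: cong_dvd_modulus)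
  have "coprime x h"
  proof (rule coprimeI)
    fix c assume c: "c dvd x" "c dvd h"
    then have "c dvd s" by (simp add: h)
    then have "c dvd g" using c by (simp add: g_def)
    then show "c dvd 1" using c gh coprime_common_divisor by blast
  qed
  then have "coprime y h" "coprime y m" "coprime y g"
    using yh ym y(1) xm by (metis cong_imp_coprime cong_sym coprime_1_left)+
  then have "coprime y (s * m)" by (simp add: h)
  moreover have "[y = x] (mod q)" if "prime q" "q dvd s" "\<not> q dvd x" for q
  proof -
    have "\<not> q dvd g" using that by (simp add: g_def)
    then have "q dvd h"
      using that by (simp add: h prime_dvd_mult_iff)
    then show ?thesis using yh cong_dvd_modulus by blast
  qed
  ultimately show ?thesis using that ym by blast
qed

text \<open>For each prime \<open>q\<close> of \<open>s\<close>, either some \<open>x i\<close>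
  vanishes modulo \<open>q\<close> and so does the product \<open>P\<close>, or all
  \<open>x i\<close> agree with \<open>y i\<close> and \<open>P\<close> is 1 modulo
  \<open>q\<close>. Either way \<open>q\<close> divides \<open>P * (P - 1)\<close>.\<close>

lemma squarefree_dvd_prod_idempotent:
  fixes x y :: "'i \<Rightarrow> int"
  assumes "squarefree s" "finite I"
    and y: "\<And>i q. i \<in> I \<Longrightarrow> prime q \<Longrightarrow> q dvd s \<Longrightarrow> \<not> q dvd x i \<Longrightarrow> [y i = x i] (mod q)"
    and one: "[(\<Prod>i\<in>I. y i) = 1] (mod s)"
  shows "[(\<Prod>i\<in>I. x i) * (\<Prod>i\<in>I. x i) = (\<Prod>i\<in>I. x i)] (mod s)"
proof -
  define P where "P = (\<Prod>i\<in>I. x i)"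
  have "s dvd P * (P - 1)"
  proof (rule squarefree_dvdI[OF assms(1)])
    fix q :: int assume q: "prime q" "q dvd s"
    show "q dvd P * (P - 1)"
    proof (cases "\<exists>i\<in>I. q dvd x i")
      case True
      then have "q dvd P"
        unfolding P_def using assms(2) by (meson dvd_prodI dvd_trans)
      then show ?thesis by simp
    next
      case False
      then have "[(\<Prod>i\<in>I. y i) = P] (mod q)"
        unfolding P_def using y q by (intro cong_prod) auto
      moreover have "[(\<Prod>i\<in>I. y i) = 1] (mod q)"
        using one q(2) by (rule cong_dvd_modulus)
      ultimately have "[P = 1] (mod q)"
        using cong_sym cong_trans by blast
      then show ?thesis by (simp add: cong_iff_dvd_diff)
    qed
  qed
  then show ?thesis
    by (simp add: P_def cong_iff_dvd_diff algebra_simps)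
qed

section \<open>The bound\<close>

text \<open>The size hypothesis is the claimed bound with both subtracted ones moved across, which
  avoids truncated subtraction.\<close>

lemma exists_idempotent_prod:
  fixes s p k :: nat and x :: "'i \<Rightarrow> int"
  assumes s: "s > 1" "squarefree s" and p: "prime p" "\<not> p dvd s" and k: "k > 0"
    and fin: "finite A"
    and card: "card A + 2 \<ge>
      davenport_constant (units_of (residue_ring (int (s * p ^ k)))) + k + totient s"
  obtains I where "I \<subseteq> A" "I \<noteq> {}"
    "[(\<Prod>i\<in>I. x i) * (\<Prod>i\<in>I. x i) = (\<Prod>i\<in>I. x i)] (mod int (s * p ^ k))"
proof -
  let ?n = "int (s * p ^ k)"
  define D where "D = davenport_constant (units_of (residue_ring ?n))"
  have "p ^ k > 0" using p(1) by (simp add: prime_gt_0_nat)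
  then have "s * p ^ k \<ge> s * 1" by (intro mult_le_mono2) linarith
  then have "?n > 1" using s(1) by linarith
  then interpret N: residues ?n "residue_ring ?n" by unfold_locales simp_all
  interpret S: residues "int s" "residue_ring (int s)"
    using s by unfold_locales simp_all
  have sf: "squarefree (int s)" using s(2) by (rule squarefree_int)
  have sp: "coprime (int s) (int p ^ k)"
    using p by (metis coprime_commute coprime_int_iff coprime_power_right_iff of_nat_power
        prime_imp_coprime)
  have prime_p: "prime (int p)" using p by simp
  have glue: "[a = b] (mod ?n)" if "[a = b] (mod int s)" "[a = b] (mod int p ^ k)" for a b
    using coprime_cong_mult[OF that sp] by simp
  define B where "B = {i \<in> A. int p dvd x i}"
  define C where "C = {i \<in> A. \<not> int p dvd x i}"
  have fBC: "finite B" "finite C" using fin by (auto simp: B_def C_def)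
  have "A = B \<union> C" "B \<inter> C = {}" by (auto simp: B_def C_def)
  then have "card A = card B + card C"
    using card_Un_disjoint[OF fBC] by simp
  \<comment> \<open>If \<open>card C \<le> D - 1\<close>, then at least
    \<open>k + totient s - 1\<close> indices remain for \<open>B\<close>.\<close>
  then consider "card C \<ge> D" | "card B + 1 \<ge> k + totient s"
    using card unfolding D_def[symmetric] by linarith
  then show ?thesis
  proof cases
    case 1
    \<comment> \<open>Terms prime to \<open>p\<close> are already units modulo the prime power, so
      only their residues modulo \<open>s\<close> are altered.\<close>
    have "\<forall>i\<in>C. \<exists>y. coprime y (int s * int p ^ k) \<and> [y = x i] (mod int p ^ k) \<and>
        (\<forall>q. prime q \<longrightarrow> q dvd int s \<longrightarrow> \<not> q dvd x i \<longrightarrow> [y = x i] (mod q))"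
    proof
      fix i assume "i \<in> C"
      then have "coprime (x i) (int p ^ k)"
        using prime_p by (auto simp: C_def coprime_commute prime_imp_coprime)
      then show "\<exists>y. coprime y (int s * int p ^ k) \<and> [y = x i] (mod int p ^ k) \<and>
        (\<forall>q. prime q \<longrightarrow> q dvd int s \<longrightarrow> \<not> q dvd x i \<longrightarrow> [y = x i] (mod q))"
        by (meson exists_unit_replacement[OF sf sp])
    qed
    then obtain y where y: "\<And>i. i \<in> C \<Longrightarrow> coprime (y i) ?n"
        "\<And>i. i \<in> C \<Longrightarrow> [y i = x i] (mod int p ^ k)"
        "\<And>i q. i \<in> C \<Longrightarrow> prime q \<Longrightarrow> q dvd int s \<Longrightarrow> \<not> q dvd x i \<Longrightarrow> [y i = x i] (mod q)"
      unfolding bchoice_iff of_nat_mult of_nat_power by blast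
    obtain I where I: "I \<subseteq> C" "I \<noteq> {}" "[(\<Prod>i\<in>I. y i) = 1] (mod ?n)"
      using N.davenport_constant_units_prod[of C y] fBC 1 y(1) unfolding D_def by blast
    have one: "[(\<Prod>i\<in>I. y i) = 1] (mod int s)" "[(\<Prod>i\<in>I. y i) = 1] (mod int p ^ k)"
      using I(3) by (auto elim!: cong_dvd_modulus)
    have "finite I" using I fBC finite_subset by blast
    then have "[(\<Prod>i\<in>I. x i) * (\<Prod>i\<in>I. x i) = (\<Prod>i\<in>I. x i)] (mod int s)"
      using squarefree_dvd_prod_idempotent[OF sf _ _ one(1), of x] y(3) I(1) by blast
    moreover have "[(\<Prod>i\<in>I. y i) = (\<Prod>i\<in>I. x i)] (mod int p ^ k)"
      using I(1) y(2) by (intro cong_prod) blast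
    then have P1: "[(\<Prod>i\<in>I. x i) = 1] (mod int p ^ k)"
      using one(2) cong_sym cong_trans by blast
    have "[(\<Prod>i\<in>I. x i) * (\<Prod>i\<in>I. x i) = (\<Prod>i\<in>I. x i)] (mod int p ^ k)"
      using cong_scalar_left[OF P1, of "\<Prod>i\<in>I. x i"] by simp
    ultimately have "[(\<Prod>i\<in>I. x i) * (\<Prod>i\<in>I. x i) = (\<Prod>i\<in>I. x i)] (mod ?n)"
      by (rule glue)
    moreover have "I \<subseteq> A" using I(1) by (auto simp: C_def)
    ultimately show ?thesis using that I(2) by blast
  next
    case 2
    \<comment> \<open>The factor 1 matches \<open>exists_unit_replacement\<close> with
      \<open>m = 1\<close>: multiples of \<open>p\<close> are replaced by units modulo
      \<open>s\<close> only.\<close>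
    have "\<forall>i\<in>B. \<exists>y. coprime y (int s * 1) \<and>
        (\<forall>q. prime q \<longrightarrow> q dvd int s \<longrightarrow> \<not> q dvd x i \<longrightarrow> [y = x i] (mod q))"
      by (meson exists_unit_replacement[OF sf coprime_1_right coprime_1_right])
    then obtain y where y: "\<And>i. i \<in> B \<Longrightarrow> coprime (y i) (int s)"
        "\<And>i q. i \<in> B \<Longrightarrow> prime q \<Longrightarrow> q dvd int s \<Longrightarrow> \<not> q dvd x i \<Longrightarrow> [y i = x i] (mod q)"
      unfolding bchoice_iff mult_1_right by blast
    obtain I where I: "I \<subseteq> B" "card I \<ge> k" "[(\<Prod>i\<in>I. y i) = 1] (mod int s)"
      using S.exists_large_prod_cong_1[of B k y] fBC 2 y(1) by auto
    have "finite I" using I fBC finite_subset by blast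
    then have "[(\<Prod>i\<in>I. x i) * (\<Prod>i\<in>I. x i) = (\<Prod>i\<in>I. x i)] (mod int s)"
      using squarefree_dvd_prod_idempotent[OF sf _ _ I(3), of x] y(2) I(1) by blast
    moreover have "int p ^ k dvd (\<Prod>i\<in>I. x i)"
    proof -
      have "(\<Prod>i\<in>I. int p) dvd (\<Prod>i\<in>I. x i)"
        using I(1) by (intro prod_dvd_prod) (auto simp: B_def)
      then show ?thesis using I(2) by (simp add: power_le_dvd)
    qed
    \<comment> \<open>At least \<open>k\<close> factors are multiples of \<open>p\<close>, so both
      sides are 0 here.\<close>
    then have "[(\<Prod>i\<in>I. x i) * (\<Prod>i\<in>I. x i) = (\<Prod>i\<in>I. x i)] (mod int p ^ k)"
      by (simp add: cong_iff_dvd_diff)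
    ultimately have "[(\<Prod>i\<in>I. x i) * (\<Prod>i\<in>I. x i) = (\<Prod>i\<in>I. x i)] (mod ?n)"
      by (rule glue)
    moreover have "I \<subseteq> A" "I \<noteq> {}" using I k by (auto simp: B_def)
    ultimately show ?thesis using that by blast
  qed
qed

theorem theorem1p5:
  fixes n s p k :: nat
  assumes "n = s * p ^ k"
    and "s > 1" and "squarefree s"
    and "prime p" and "\<not> p dvd s"
    and "k > 0"
  shows "int (erdos_burgess_constant (residue_ring (int n)))
    \<le> int (davenport_constant (units_of (residue_ring (int n))))
      + (int k - 1) + (int (totient s) - 1)"
proof -
  let ?R = "residue_ring (int n)"
  define D where "D = davenport_constant (units_of ?R)"
  define t where "t = D + (k - 1) + (totient s - 1)"
  have "p ^ k > 0" using assms(4) by (simp add: prime_gt_0_nat)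
  then have "s * p ^ k \<ge> s * 1" by (intro mult_le_mono2) linarith
  then have "int n > 1" using assms(1,2) by linarith
  then interpret N: residues "int n" ?R by unfold_locales simp_all
  have D: "D > 0" using N.davenport_constant_units_pos by (simp add: D_def)
  have tot: "totient s > 0" using assms(2) by simp
  have "\<exists>ys. subseq ys xs \<and> ys \<noteq> [] \<and> seq_prod ?R ys \<otimes>\<^bsub>?R\<^esub> seq_prod ?R ys = seq_prod ?R ys"
    if len: "length xs = t" for xs
  proof -
    \<comment> \<open>Since \<open>k\<close> and \<open>totient s\<close> are positive, the natural
      subtractions in \<open>t\<close> do not truncate.\<close>
    have "card {..<length xs} + 2 \<ge> D + k + totient s"
      using len tot assms(6) by (simp add: t_def)
    then obtain I where I: "I \<subseteq> {..<length xs}" "I \<noteq> {}"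
      "[(\<Prod>i\<in>I. xs ! i) * (\<Prod>i\<in>I. xs ! i) = (\<Prod>i\<in>I. xs ! i)] (mod int n)"
      using exists_idempotent_prod[OF assms(2-6), of "{..<length xs}" "(!) xs"] assms(1)
      unfolding D_def by blast
    \<comment> \<open>Listing \<open>I\<close> in increasing order turns the chosen index set back
      into a subsequence of \<open>xs\<close>.\<close>
    define js where "js = filter (\<lambda>i. i \<in> I) [0..<length xs]"
    have js: "set js = I" "distinct js" using I(1) by (auto simp: js_def)
    have prod: "prod_list (map ((!) xs) js) = (\<Prod>i\<in>I. xs ! i)"
      using js prod.distinct_set_conv_list by metis
    have "subseq (map ((!) xs) js) xs"
      unfolding js_def by (rule subseq_nth_filter)
    moreover have "map ((!) xs) js \<noteq> []" using I(2) js(1) by auto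
    moreover have "seq_prod ?R (map ((!) xs) js) \<otimes>\<^bsub>?R\<^esub> seq_prod ?R (map ((!) xs) js)
        = seq_prod ?R (map ((!) xs) js)"
      using I(3) by (simp add: N.seq_prod_eq_prod_list prod N.mult_cong cong_def)
    ultimately show ?thesis by blast
  qed
  then have "erdos_burgess_constant ?R \<le> t"
    unfolding erdos_burgess_constant_def using D by (intro Least_le) (auto simp: t_def)
  then show ?thesis
    using tot assms(6) unfolding D_def[symmetric] t_def by linarith
qed

end
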